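(* Let $\beta>0$, $c\ge 0$, $\sigma\ge0$, $\beta^k\equiv\beta$ and $c^k=c(1-\tau^k)\beta^k/\tau^k$ for all $k\ge 0$, where $\tau^k>0$, $1/(\tau^{k-1})^2=(1-\tau^k)/(\tau^k)^2$ for $k\ge 0$ and $\tau^{-1}\in(0,1)$. Let $x'\in\Omega$ and $\lambda\in\mathbb{R}^l$. Suppose that $\{\breve x^k\}$, $\{\widetilde u^k\}$, $\{v^k\}$, $\{z^k\}$ are generated by the following prediction-correction framework: for every $k\ge 0$, with given $\breve x^{k-1}$ and $v^k$, the points $\breve x^k$ and $\widetilde u^k=(\widetilde x^k,\widetilde\lambda^k)$ satisfy $\widetilde x^k=\frac{1}{\tau^k}\breve x^k-\frac{1-\tau^k}{\tau^k}\breve x^{k-1}$ and $$\frac{1}{(\tau^k)^2}[f(x)-f(\breve x^k)]-\frac{1}{(\tau^{k-1})^2}[f(x)-f(\breve x^{k-1})]+\frac1{\tau^k}(u-\widetilde u^k)^TF(\widetilde u^k)+c^k(A(x-\widetilde x^k))^T(A\breve x^{k-1}-b)$$ $$\ge \frac1{\tau^k}\Big[(v-\widetilde v^k)^TQ^k(v^k-\widetilde v^k)+\frac{\sigma}{2}\|z^k-z\|_R^2\Big]\quad\forall u,$$ and $v^{k+1}=v^k-M^k(v^k-\widetilde v^k)$. Suppose that for each $k$ there exists a matrix $H^k$ with $Q^k=H^kM^k$, and put $G^k:=(Q^k)^T+Q^k-(M^k)^TH^kM^k$. Suppose further that there are matrices $H_0^k\succeq 0$ and numbers $\varTheta^k\ge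 0$ such that for all $k\ge 0$ $$\frac1{\tau^k}\left(\|v^{k+1}-v'\|^2_{H^k}+\sigma\|z^k-z'\|_R^2-\|v^k-v'\|^2_{H^k}+\|v^k-\widetilde v^k\|^2_{G^k}\right)\ \ge\ \|v^{k+1}-v'\|^2_{H_0^{k+1}}-\|v^k-v'\|^2_{H_0^k}+\varTheta^{k+1}-\varTheta^k$$ and $$\varTheta^{k+1}-\varTheta^k\ge c\,\beta^k\Big(\|A\widetilde x^k-b\|^2-\frac{\tau^k}{(\tau^{k-1})^2}\|A\breve x^{k-1}-b\|^2\Big).$$ Then $$f(\breve x^k)-f(x')-\lambda^T(A\breve x^k-b)\le O(1/k^2),$$ i.e. there is a constant $C$ independent of $k$ such that the left-hand side is at most $C/k^2$ for all $k\ge 1$.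
   Context: Problem: minimize $f(x)$ subject to $Ax=b$, with $f:\mathbb{R}^n\to\mathbb{R}$ closed, proper, convex, $A\in\mathbb{R}^{l\times n}$, $b\in\mathbb{R}^l$; $\Omega=\{x:Ax=b\}$. It is considered in one of three forms: (P1) no further structure; (P2) $x=(x_1,x_2)$, $f(x)=f_1(x_1)+f_2(x_2)$, $Ax=A_1x_1+A_2x_2$; (P3) $x=(x_1,\dots,x_m)$, $m\ge2$, $f(x)=\sum_{i=1}^m f_i(x_i)$, $Ax=\sum_{i=1}^m A_ix_i$, all $f_i$ closed proper convex real-valued. For $x\in\mathbb{R}^n$, $\lambda\in\mathbb{R}^l$ put $u=(x,\lambda)$ and $F(u)=(-A^T\lambda,\ Ax-b)$. The vector $v$ associated with $u$ is $v=(x,\lambda)$ for (P1), $v=(x_2,\lambda)$ for (P2), and $v=(A_2x_2,\dots,A_mx_m,\lambda)$ for (P3). Likewise $\widetilde v^k$ is the vector associated with $\widetilde u^k$, and $v'$ is the vector associated with $u'=(x',\lambda)$. The auxiliary variable $z$ is a fixed function of $x$ (for instance $z=x$, $z=x_i$, or $z=\nabla f_i(x_i)$), $z'$ is its value at $x'$, $z^k$ are given vectors in the same space, and $R\succeq0$. The $v^k$ are vectors in the same space as $v$ ($v^0$ and $\breve x^{-1}$ are given), and $Q^k,M^k,H^k,H_0^k$ are real square matrices of matching size; $Q^k$ need not be symmetric. $\|w\|_D^2:=w^TDw$, whether or not $D$ is positive semidefinite.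
   Formalization: The matrices H^k are additionally assumed symmetric (not necessarily positive semidefinite); without symmetry the claim fails, e.g. for linear f, A=0, c=σ=0, H^k=Q^k a 90-degree rotation on x and M^k the identity on x. *)

theory Defs
  imports "HOL-Analysis.Analysis"
begin

text \<open>Properness is automatic for a finite-valued function on a nonempty set.\<close>

definition closed_proper_convex_on :: "'a::euclidean_space set \<Rightarrow> ('a \<Rightarrow> real) \<Rightarrow> bool" where
  "closed_proper_convex_on S f \<longleftrightarrow> S \<noteq> {} \<and> convex_on S f \<and> closed (epigraph S f)"

definition wnorm2 :: "real^'d^'d \<Rightarrow> real^'d \<Rightarrow> real" where
  "wnorm2 D w = w \<bullet> (D *v w)"

definition sym_mat :: "real^'d^'d \<Rightarrow> bool" where
  "sym_mat D \<longleftrightarrow> transpose D = D"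

definition psd :: "real^'d^'d \<Rightarrow> bool" where
  "psd D \<longleftrightarrow> sym_mat D \<and> (\<forall>w. wnorm2 D w \<ge> 0)"

definition feasible_set :: "real^'n^'l \<Rightarrow> real^'l \<Rightarrow> (real^'n) set" where
  "feasible_set A b = {x. A *v x = b}"

text \<open>The saddle-point operator on pairs \<open>u = (x, \<lambda>)\<close>.\<close>

definition saddle_op :: "real^'n^'l \<Rightarrow> real^'l \<Rightarrow> (real^'n) \<times> (real^'l) \<Rightarrow> (real^'n) \<times> (real^'l)" where
  "saddle_op A b u = (- (transpose A *v snd u), A *v fst u - b)"

text \<open>
  A splitting \<open>x = (x\<^sub>1, \<dots>, x\<^sub>m)\<close> into blocks of arbitrary, possibly different sizes is a labelling
  \<open>p\<close> of the coordinates by block numbers.  The space of the \<open>i\<close>-th block is identified with the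
  coordinate subspace of vectors vanishing outside block \<open>i\<close>, and \<open>x\<^sub>i\<close> with the zero-padded
  vector.  Accordingly \<open>A\<^sub>i\<close> is padded to \<open>n\<close> columns; the columns outside block \<open>i\<close> are never used.
\<close>

definition block :: "('n \<Rightarrow> nat) \<Rightarrow> nat \<Rightarrow> real^'n \<Rightarrow> real^'n" where
  "block p i x = (\<chi> j. if p j = i then x $ j else 0)"

definition block_space :: "('n \<Rightarrow> nat) \<Rightarrow> nat \<Rightarrow> (real^'n) set" where
  "block_space p i = {x. \<forall>j. p j \<noteq> i \<longrightarrow> x $ j = 0}"

definition separable ::
  "nat \<Rightarrow> ('n \<Rightarrow> nat) \<Rightarrow> (nat \<Rightarrow> real^'n \<Rightarrow> real) \<Rightarrow> (nat \<Rightarrow> real^'n^'l) \<Rightarrow>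
    (real^'n \<Rightarrow> real) \<Rightarrow> real^'n^'l \<Rightarrow> bool" where
  "separable m p fs As f A \<longleftrightarrow>
     range p = {1..m} \<and>
     (\<forall>i\<in>{1..m}. closed_proper_convex_on (block_space p i) (fs i)) \<and>
     (\<forall>x. f x = (\<Sum>i=1..m. fs i (block p i x))) \<and>
     (\<forall>x. A *v x = (\<Sum>i=1..m. As i *v block p i x))"

text \<open>
  The three problem forms, each together with the map \<open>V\<close> sending \<open>u = (x, \<lambda>)\<close> to its associated
  vector \<open>v\<close>.  So that all forms share one type for \<open>v\<close>, the coordinates of \<open>v\<close> are indexed by a
  finite type \<open>'v\<close>, and the bijection \<open>e\<close> tells which entry of the block vector stands at each
  index; its existence forces \<open>'v\<close> to have exactly the right number of elements.
\<close>

definition form_P1 :: "((real^'n) \<times> (real^'l) \<Rightarrow> real^'v) \<Rightarrow> bool" where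
  "form_P1 V \<longleftrightarrow>
     (\<exists>e :: 'v \<Rightarrow> 'n + 'l.
        bij_betw e UNIV UNIV \<and>
        (\<forall>x l i. V (x, l) $ i = (case e i of Inl j \<Rightarrow> x $ j | Inr r \<Rightarrow> l $ r)))"

definition form_P2 ::
  "(real^'n \<Rightarrow> real) \<Rightarrow> real^'n^'l \<Rightarrow> ((real^'n) \<times> (real^'l) \<Rightarrow> real^'v) \<Rightarrow> bool" where
  "form_P2 f A V \<longleftrightarrow>
     (\<exists>p fs As. separable 2 p fs As f A \<and>
       (\<exists>e :: 'v \<Rightarrow> 'n + 'l.
          bij_betw e UNIV ({j. p j = 2} <+> UNIV) \<and>
          (\<forall>x l i. V (x, l) $ i = (case e i of Inl j \<Rightarrow> x $ j | Inr r \<Rightarrow> l $ r))))"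

definition form_P3 ::
  "(real^'n \<Rightarrow> real) \<Rightarrow> real^'n^'l \<Rightarrow> ((real^'n) \<times> (real^'l) \<Rightarrow> real^'v) \<Rightarrow> bool" where
  "form_P3 f A V \<longleftrightarrow>
     (\<exists>m p fs As. m \<ge> 2 \<and> separable m p fs As f A \<and>
       (\<exists>e :: 'v \<Rightarrow> (nat \<times> 'l) + 'l.
          bij_betw e UNIV (({2..m} \<times> UNIV) <+> UNIV) \<and>
          (\<forall>x l i. V (x, l) $ i =
             (case e i of Inl (q, r) \<Rightarrow> (As q *v block p q x) $ r | Inr r \<Rightarrow> l $ r))))"

end

theory Submission
  imports Defs
begin

text \<open>
  Write \<open>t\<^sub>k = 1 / \<tau>\<^sup>k\<close>, so that \<open>t\<^sub>k\<^sup>2 - t\<^sub>k = t\<^sub>k\<^sub>-\<^sub>1\<^sup>2\<close>, put \<open>r\<^sub>k = A x\<^sub>k - b\<close> for the averaged iterates \<open>x\<^sub>k\<close>, and let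
  \<open>E\<^sub>k = f x\<^sub>k - f x' - \<lambda> \<bullet> r\<^sub>k\<close>.  Evaluate the prediction inequality at \<open>u = (x', \<lambda>)\<close>.  The saddle
  term becomes \<open>\<lambda> \<bullet> (t\<^sub>k\<^sup>2 r\<^sub>k - t\<^sub>k\<^sub>-\<^sub>1\<^sup>2 r\<^sub>k\<^sub>-\<^sub>1)\<close>, the correction step turns the \<open>Q\<close>-term into the left-hand
  side of the descent assumption, and a polarisation of the penalty term together with the growth of
  \<open>\<theta>\<close> cancels \<open>\<theta>\<close>.  Hence
  \<open>t\<^sub>k\<^sup>2 E\<^sub>k + (c \<beta> / 2) t\<^sub>k\<^sup>2 \<parallel>r\<^sub>k\<parallel>\<^sup>2 + (1/2) \<parallel>v\<^sub>k\<^sub>+\<^sub>1 - v'\<parallel>\<^sup>2\<close>, with the last norm taken in \<open>H\<^sub>0\<close>,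
  is nonincreasing, and \<open>t\<^sub>k \<ge> k / 2\<close>.
\<close>

lemma wnorm2_diff:
  assumes "sym_mat H"
  shows "wnorm2 H (p - q) = wnorm2 H p - 2 * (p \<bullet> (H *v q)) + wnorm2 H q"
proof -
  have "q \<bullet> (H *v p) = p \<bullet> (H *v q)"
    using assms by (metis dot_lmul_matrix inner_commute sym_mat_def transpose_matrix_vector)
  then show ?thesis
    by (simp add: wnorm2_def matrix_vector_mult_diff_distrib inner_diff_left inner_diff_right)
qed

text \<open>Put d = \<open>v0 - vt\<close>. Expanding the \<open>H\<close>-norm of
  \<open>v1 - w\<close> = (\<open>v0 - w\<close>) - \<open>M\<close> d produces the cross term with
  \<open>H\<close> \<open>M\<close> = \<open>Q\<close> and the square of \<open>M\<close> d; the
  latter is exactly what the definition of \<open>G\<close> subtracts.\<close>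

lemma prediction_correction_identity:
  assumes sym: "sym_mat H"
    and Q: "Q = H ** M"
    and G: "G = transpose Q + Q - transpose M ** H ** M"
    and step: "v1 = v0 - M *v (v0 - vt)"
  shows "2 * ((w - vt) \<bullet> (Q *v (v0 - vt)))
    = wnorm2 H (v1 - w) - wnorm2 H (v0 - w) + wnorm2 G (v0 - vt)"
proof -
  define d where "d = v0 - vt"
  have Qd: "Q *v d = H *v (M *v d)"
    by (simp add: Q matrix_vector_mul_assoc)
  have "d \<bullet> (transpose Q *v d) = d \<bullet> (Q *v d)"
    by (metis dot_lmul_matrix inner_commute transpose_matrix_vector)
  moreover have "d \<bullet> ((transpose M ** H ** M) *v d) = wnorm2 H (M *v d)"
    by (metis (no_types) dot_lmul_matrix matrix_vector_mul_assoc transpose_matrix_vector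
        transpose_transpose wnorm2_def)
  ultimately have Gd: "wnorm2 G d = 2 * (d \<bullet> (Q *v d)) - wnorm2 H (M *v d)"
    by (simp add: wnorm2_def G matrix_vector_mult_add_rdistrib matrix_vector_mult_diff_rdistrib
        inner_add_right inner_diff_right)
  have "v1 - w = (v0 - w) - M *v d"
    by (simp add: step d_def)
  then have Hd: "wnorm2 H (v1 - w)
      = wnorm2 H (v0 - w) - 2 * ((v0 - w) \<bullet> (Q *v d)) + wnorm2 H (M *v d)"
    by (simp only: wnorm2_diff[OF sym] Qd)
  have "w - vt = d - (v0 - w)"
    by (simp add: d_def)
  then have "(w - vt) \<bullet> (Q *v d) = d \<bullet> (Q *v d) - (v0 - w) \<bullet> (Q *v d)"
    by (simp only: inner_diff_left)
  then show ?thesis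
    using Gd Hd unfolding d_def by linarith
qed

text \<open>As \<open>A *v x' = b\<close>, the primal part contributes \<open>snd u\<close> against
  the residual \<open>A *v fst u - b\<close>, which cancels the same term of the dual part and
  leaves only \<open>l\<close>.\<close>

lemma saddle_op_inner_feasible:
  assumes "x' \<in> feasible_set A b"
  shows "((x', l) - u) \<bullet> saddle_op A b u = l \<bullet> (A *v fst u - b)"
proof -
  have "(x' - fst u) \<bullet> (transpose A *v snd u) = snd u \<bullet> (b - A *v fst u)"
    using assms dot_lmul_matrix[of "snd u" A "x' - fst u"]
    by (simp add: feasible_set_def inner_commute[of "x' - fst u"]
        matrix_vector_mult_diff_distrib transpose_matrix_vector)
  then show ?thesis
    by (cases u) (simp add: saddle_op_def inner_diff_left inner_diff_right)
qed

text \<open>Completing the square turns the recursion into (t_{k+1} - 1/2)^2 = t_k^2 + 1/4, so each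
  step gains more than 1/2.\<close>

lemma acceleration_growth:
  fixes t :: "nat \<Rightarrow> real"
  assumes pos: "\<And>k. t k > 0"
    and rec: "\<And>k. (t (Suc k))\<^sup>2 - t (Suc k) = (t k)\<^sup>2"
  shows "real k / 2 < t k"
proof (induction k)
  case 0
  then show ?case using pos[of 0] by simp
next
  case (Suc k)
  have sq: "(t (Suc k) - 1 / 2)\<^sup>2 = (t k)\<^sup>2 + 1 / 4"
    using rec[of k] by (simp add: power2_eq_square algebra_simps)
  \<comment> \<open>This forces \<open>t (Suc k) > 1\<close>, so the base
    \<open>t (Suc k) - 1 / 2\<close> is nonnegative and the squares can be compared.\<close>
  have "t (Suc k) * (t (Suc k) - 1) > 0"
    using rec[of k] zero_less_power[OF pos[of k], of 2]
    by (simp add: power2_eq_square algebra_simps)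
  then have "t (Suc k) > 1"
    using pos[of "Suc k"] by (simp add: zero_less_mult_iff)
  moreover have "(t k)\<^sup>2 < (t (Suc k) - 1 / 2)\<^sup>2"
    using sq by simp
  ultimately have "t k < t (Suc k) - 1 / 2"
    by (intro power_less_imp_less_base[of "t k" 2]) auto
  then show ?case using Suc by simp
qed

text \<open>Expand the square of t r1 = d + (t - 1) r0 and split (t - 1)^2 = (t^2 - t) - (t - 1):
  the weight t^2 - t telescopes, while the rest matches the growth bound for
  \<open>\<theta>\<close>.\<close>

lemma extrapolation_penalty:
  fixes r0 r1 d :: "'a::real_inner"
  assumes d: "d = t *\<^sub>R r1 - (t - 1) *\<^sub>R r0"
  shows "- 2 * (t - 1) * (d \<bullet> r0)
    = ((norm d)\<^sup>2 - (t - 1) * (norm r0)\<^sup>2) + (t\<^sup>2 - t) * (norm r0)\<^sup>2 - t\<^sup>2 * (norm r1)\<^sup>2"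
  unfolding d power2_norm_eq_inner
  by (simp add: inner_diff_left inner_diff_right inner_commute[of r1 r0] power2_eq_square
      algebra_simps)

theorem lemma4p2:
  fixes f :: "real^'n \<Rightarrow> real" and A :: "real^'n^'l" and b :: "real^'l"
    and V :: "(real^'n) \<times> (real^'l) \<Rightarrow> real^'v"
    and zmap :: "real^'n \<Rightarrow> real^'r" and R :: "real^'r^'r"
    and \<beta> c \<sigma> :: real and \<beta>s cs :: "nat \<Rightarrow> real" and \<tau> :: "int \<Rightarrow> real"
    and x' :: "real^'n" and l :: "real^'l"
    and xbreve :: "int \<Rightarrow> real^'n" and utilde :: "nat \<Rightarrow> (real^'n) \<times> (real^'l)"
    and v :: "nat \<Rightarrow> real^'v" and z :: "nat \<Rightarrow> real^'r"
    and Q M H G H0 :: "nat \<Rightarrow> real^'v^'v" and \<theta> :: "nat \<Rightarrow> real"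
  assumes f: "closed_proper_convex_on UNIV f"
    and form: "form_P1 V \<or> form_P2 f A V \<or> form_P3 f A V"
    and R: "psd R"
    and params: "\<beta> > 0" "c \<ge> 0" "\<sigma> \<ge> 0"
    and betas: "\<forall>k. \<beta>s k = \<beta>"
    and cs: "\<forall>k. cs k = c * (1 - \<tau> (int k)) * \<beta>s k / \<tau> (int k)"
    and tau_pos: "\<forall>k::nat. \<tau> (int k) > 0"
    and tau_rec: "\<forall>k::nat. 1 / (\<tau> (int k - 1))\<^sup>2 = (1 - \<tau> (int k)) / (\<tau> (int k))\<^sup>2"
    and tau_init: "\<tau> (- 1) \<in> {0<..<1}"
    and x': "x' \<in> feasible_set A b"
    and xtilde: "\<forall>k::nat. fst (utilde k) =
        (1 / \<tau> (int k)) *\<^sub>R xbreve (int k)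
        - ((1 - \<tau> (int k)) / \<tau> (int k)) *\<^sub>R xbreve (int k - 1)"
    and prediction: "\<forall>k::nat. \<forall>u.
        1 / (\<tau> (int k))\<^sup>2 * (f (fst u) - f (xbreve (int k)))
        - 1 / (\<tau> (int k - 1))\<^sup>2 * (f (fst u) - f (xbreve (int k - 1)))
        + 1 / \<tau> (int k) * ((u - utilde k) \<bullet> saddle_op A b (utilde k))
        + cs k * ((A *v (fst u - fst (utilde k))) \<bullet> (A *v xbreve (int k - 1) - b))
        \<ge> 1 / \<tau> (int k) *
            ((V u - V (utilde k)) \<bullet> (Q k *v (v k - V (utilde k)))
             + \<sigma> / 2 * wnorm2 R (z k - zmap (fst u)))"
    and correction: "\<forall>k. v (Suc k) = v k - M k *v (v k - V (utilde k))"
    and H_sym: "\<forall>k. sym_mat (H k)"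
    and Q_eq: "\<forall>k. Q k = H k ** M k"
    and G_eq: "\<forall>k. G k = transpose (Q k) + Q k - transpose (M k) ** H k ** M k"
    and H0: "\<forall>k. psd (H0 k)"
    and theta_nonneg: "\<forall>k. \<theta> k \<ge> 0"
    and descent: "\<forall>k.
        1 / \<tau> (int k) *
          (wnorm2 (H k) (v (Suc k) - V (x', l)) + \<sigma> * wnorm2 R (z k - zmap x')
           - wnorm2 (H k) (v k - V (x', l)) + wnorm2 (G k) (v k - V (utilde k)))
        \<ge> wnorm2 (H0 (Suc k)) (v (Suc k) - V (x', l)) - wnorm2 (H0 k) (v k - V (x', l))
           + \<theta> (Suc k) - \<theta> k"
    and theta_growth: "\<forall>k. \<theta> (Suc k) - \<theta> k
        \<ge> c * \<beta>s k *
            ((norm (A *v fst (utilde k) - b))\<^sup>2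
             - \<tau> (int k) / (\<tau> (int k - 1))\<^sup>2 * (norm (A *v xbreve (int k - 1) - b))\<^sup>2)"
  shows "\<exists>C. \<forall>k\<ge>1::nat.
      f (xbreve (int k)) - f x' - l \<bullet> (A *v xbreve (int k) - b) \<le> C / (real k)\<^sup>2"
proof -
  \<comment> \<open>\<open>t\<close>, \<open>r\<close> and \<open>E\<close> are shifted by one, so
    that index 0 stands for the given iterate -1. \<open>P\<close> is not shifted, hence
    \<open>L 0\<close> pairs \<open>xbreve (- 1)\<close> with \<open>v 0\<close>.\<close>
  define t where "t k = 1 / \<tau> (int k - 1)" for k :: nat
  define r where "r k = A *v xbreve (int k - 1) - b" for k :: nat
  define E where "E k = f (xbreve (int k - 1)) - f x' - l \<bullet> r k" for k :: nat
  define P where "P k = wnorm2 (H0 k) (v k - V (x', l))" for k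
  define L where
    "L k = (t k)\<^sup>2 * E k + c * \<beta> / 2 * ((t k)\<^sup>2 * (norm (r k))\<^sup>2) + P k / 2" for k
  have Ax': "A *v x' = b"
    using x' by (simp add: feasible_set_def)
  have t_pos: "t k > 0" for k
    using tau_pos tau_init by (cases k) (auto simp: t_def)
  have t_rec: "(t (Suc k))\<^sup>2 - t (Suc k) = (t k)\<^sup>2" for k
    using tau_rec[rule_format, of k] tau_pos[rule_format, of k]
    by (simp add: t_def power2_eq_square field_simps)
  have P_nonneg: "P k \<ge> 0" for k
    using H0 by (simp add: P_def psd_def)
  have L_step: "L (Suc k) \<le> L k" for k
  proof -
    define T where "T = t (Suc k)"
    define d where "d = A *v fst (utilde k) - b"
    have tau: "\<tau> (int k) > 0"
      using tau_pos by blast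
    have T: "1 / \<tau> (int k) = T"
      by (simp add: T_def t_def)
    have T1: "(1 - \<tau> (int k)) / \<tau> (int k) = T - 1"
      using tau by (simp add: T[symmetric] diff_divide_distrib)
    have tk: "1 / (\<tau> (int k - 1))\<^sup>2 = T\<^sup>2 - T" "1 / (\<tau> (int k))\<^sup>2 = T\<^sup>2"
      using t_rec[of k] by (simp_all add: T_def t_def power_one_over)
    have tau_div: "\<tau> (int k) / (\<tau> (int k - 1))\<^sup>2 = T - 1"
    proof -
      have "\<tau> (int k) / (\<tau> (int k - 1))\<^sup>2 = \<tau> (int k) * (T\<^sup>2 - T)"
        using tk(1) by (metis divide_inverse inverse_eq_divide)
      also have "\<dots> = (\<tau> (int k) * T) * (T - 1)"
        by (simp add: power2_eq_square algebra_simps)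
      also have "\<tau> (int k) * T = 1"
        using tau by (simp add: T[symmetric])
      finally show ?thesis by simp
    qed
    \<comment> \<open>The extrapolation weights sum to 1, so residuals extrapolate just as the
      points do.\<close>
    have d: "d = T *\<^sub>R r (Suc k) - (T - 1) *\<^sub>R r k"
      unfolding d_def xtilde[rule_format] T T1
      by (simp add: r_def matrix_vector_mult_diff_distrib matrix_vector_mult_scaleR algebra_simps)
    have Tl: "T * (l \<bullet> d) = T\<^sup>2 * (l \<bullet> r (Suc k)) - (T\<^sup>2 - T) * (l \<bullet> r k)"
      by (simp add: d inner_diff_right power2_eq_square algebra_simps)
    have csk: "cs k = c * \<beta> * (T - 1)"
      using cs betas by (simp add: T1[symmetric])
    have Ad: "A *v (x' - fst (utilde k)) = - d"
      by (simp add: d_def Ax' matrix_vector_mult_diff_distrib)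
    \<comment> \<open>The bracket bounded by the prediction at \<open>(x', l)\<close>; twice it is
      the bracket of the descent assumption.\<close>
    define S where "S = (V (x', l) - V (utilde k)) \<bullet> (Q k *v (v k - V (utilde k)))
        + \<sigma> / 2 * wnorm2 R (z k - zmap x')"
    have "T\<^sup>2 * (f x' - f (xbreve (int k)))
        - (T\<^sup>2 - T) * (f x' - f (xbreve (int k - 1)))
        + T * (l \<bullet> d) - c * \<beta> * (T - 1) * (d \<bullet> r k) \<ge> T * S"
      using prediction[rule_format, of k "(x', l)"]
      unfolding saddle_op_inner_feasible[OF x'] tk T csk fst_conv Ad S_def
        d_def[symmetric] r_def[symmetric]
      by simp
    then have pred: "T * S \<le> (T\<^sup>2 - T) * E k - T\<^sup>2 * E (Suc k) - c * \<beta> * (T - 1) * (d \<bullet> r k)"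
      unfolding Tl by (simp add: E_def algebra_simps)
    have S2: "2 * S = wnorm2 (H k) (v (Suc k) - V (x', l)) + \<sigma> * wnorm2 R (z k - zmap x')
        - wnorm2 (H k) (v k - V (x', l)) + wnorm2 (G k) (v k - V (utilde k))"
      using prediction_correction_identity[OF H_sym[rule_format] Q_eq[rule_format]
          G_eq[rule_format] correction[rule_format], of "V (x', l)" k]
      by (simp add: S_def)
    have desc: "2 * (T * S) \<ge> P (Suc k) - P k + \<theta> (Suc k) - \<theta> k"
      using descent[rule_format, of k] unfolding S2[symmetric] T P_def by simp
    have growth: "\<theta> (Suc k) - \<theta> k \<ge> c * \<beta> * ((norm d)\<^sup>2 - (T - 1) * (norm (r k))\<^sup>2)"
      using theta_growth[rule_format, of k] unfolding tau_div
      by (simp add: betas d_def r_def)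
    have "- 2 * (c * \<beta> * (T - 1) * (d \<bullet> r k)) = c * \<beta> * (- 2 * (T - 1) * (d \<bullet> r k))"
      by (simp only: mult.assoc mult.left_commute[of _ "- 2"])
    also have "\<dots> = c * \<beta> * ((norm d)\<^sup>2 - (T - 1) * (norm (r k))\<^sup>2)
        + c * \<beta> * ((T\<^sup>2 - T) * (norm (r k))\<^sup>2) - c * \<beta> * (T\<^sup>2 * (norm (r (Suc k)))\<^sup>2)"
      unfolding extrapolation_penalty[OF d] by (simp only: distrib_left right_diff_distrib)
    finally have pen: "- 2 * (c * \<beta> * (T - 1) * (d \<bullet> r k))
      = c * \<beta> * ((norm d)\<^sup>2 - (T - 1) * (norm (r k))\<^sup>2)
        + c * \<beta> * ((T\<^sup>2 - T) * (norm (r k))\<^sup>2) - c * \<beta> * (T\<^sup>2 * (norm (r (Suc k)))\<^sup>2)" .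
    \<comment> \<open>Chaining \<open>desc\<close> with twice \<open>pred\<close>, the first summand
      of \<open>pen\<close> is absorbed by the increment of \<open>\<theta>\<close> through
      \<open>growth\<close>; halving gives the factors 1/2 in \<open>L\<close>.\<close>
    have "(t k)\<^sup>2 = T\<^sup>2 - T" "t (Suc k) = T"
      using t_rec[of k] by (simp_all add: T_def)
    then show ?thesis
      using pred desc growth pen unfolding L_def by simp
  qed
  have L_le: "L k \<le> L 0" for k
    by (induction k) (use L_step order_trans in blast)+
  \<comment> \<open>The 4 comes from squaring k/2. The absolute value makes the numerator
    nonnegative, so that replacing T^2 by the smaller (k/2)^2 only enlarges the quotient.\<close>
  have bound: "f (xbreve (int k)) - f x' - l \<bullet> (A *v xbreve (int k) - b) \<le> 4 * \<bar>L 0\<bar> / (real k)\<^sup>2"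
    if "k \<ge> 1" for k :: nat
  proof -
    define T where "T = t (Suc k)"
    have "c * \<beta> / 2 * (T\<^sup>2 * (norm (r (Suc k)))\<^sup>2) \<ge> 0"
      using params by simp
    then have "T\<^sup>2 * E (Suc k) \<le> \<bar>L 0\<bar>"
      using L_le[of "Suc k"] P_nonneg[of "Suc k"] unfolding L_def[of "Suc k"] T_def by linarith
    moreover have T: "real k / 2 < T"
      using acceleration_growth[of t, OF t_pos t_rec, of "Suc k"] by (simp add: T_def)
    ultimately have "E (Suc k) \<le> \<bar>L 0\<bar> / T\<^sup>2"
      using that by (simp add: pos_le_divide_eq mult.commute)
    also have "\<dots> \<le> \<bar>L 0\<bar> / (real k / 2)\<^sup>2"
      using T that by (intro divide_left_mono power_mono mult_pos_pos zero_less_power) auto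
    also have "\<dots> = 4 * \<bar>L 0\<bar> / (real k)\<^sup>2"
      by (simp add: power_divide)
    finally show ?thesis
      by (simp add: E_def r_def)
  qed
  then show ?thesis
    by blast
qed

end
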